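(* Let $k$ be an algebraically closed field of characteristic zero and let $L$ be an $n$-dimensional metabelian Lie algebra over $k$ with $\dim[L,L]\ge 2$. If $n\le 9$, then $L$ satisfies Rentschler's property.
   Context: Here "metabelian" means $[L,L]\subset Z(L)$, where $Z(L)$ is the center of $L$. For $\xi\in L^*$ put $L(\xi)=\{x\in L : \xi([x,y])=0 \text{ for all } y\in L\}$; the index is $i(L)=\min_{\xi\in L^*}\dim L(\xi)$; the magic number is $c(L)=(\dim L+i(L))/2$ (an integer). $\alpha(L)$ denotes the maximum dimension of an abelian subalgebra of $L$. $L$ satisfies Rentschler's property if $\alpha(L)\ge c(L)-1$. *)

theory Defs
  imports Complex_Main "HOL-Computational_Algebra.Computational_Algebra"
begin

locale lie_algebra = vector_space scale
  for scale :: "'k::field \<Rightarrow> 'l::ab_group_add \<Rightarrow> 'l" +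
  fixes bracket :: "'l \<Rightarrow> 'l \<Rightarrow> 'l"
  assumes linear_right: "Vector_Spaces.linear scale scale (\<lambda>y. bracket x y)"
    and linear_left: "Vector_Spaces.linear scale scale (\<lambda>x. bracket x y)"
    and alternating: "bracket x x = 0"
    and jacobi: "bracket x (bracket y z) + bracket y (bracket z x) + bracket z (bracket x y) = 0"
begin

definition derived_algebra :: "'l set" where
  "derived_algebra = span {bracket x y | x y. True}"

definition center :: "'l set" where
  "center = {z. \<forall>x. bracket z x = 0}"

(* Some authors call this "two-step nilpotent" and use "metabelian" for the weaker
   condition that the derived algebra is abelian. *)
definition metabelian :: bool where
  "metabelian \<longleftrightarrow> derived_algebra \<subseteq> center"

definition dual_space :: "('l \<Rightarrow> 'k) set" where
  "dual_space = {\<xi>. Vector_Spaces.linear scale (*) \<xi>}"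

definition stabilizer :: "('l \<Rightarrow> 'k) \<Rightarrow> 'l set" where
  "stabilizer \<xi> = {x. \<forall>y. \<xi> (bracket x y) = 0}"

(* Minimum of a nonempty set of natural numbers. *)
definition index :: nat where
  "index = Inf ((\<lambda>\<xi>. dim (stabilizer \<xi>)) ` dual_space)"

definition magic_number :: rat where
  "magic_number = (of_nat (dim (UNIV :: 'l set)) + of_nat index) / 2"

definition subalgebra :: "'l set \<Rightarrow> bool" where
  "subalgebra A \<longleftrightarrow> subspace A \<and> (\<forall>x\<in>A. \<forall>y\<in>A. bracket x y \<in> A)"

definition abelian_subalgebra :: "'l set \<Rightarrow> bool" where
  "abelian_subalgebra A \<longleftrightarrow> subalgebra A \<and> (\<forall>x\<in>A. \<forall>y\<in>A. bracket x y = 0)"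

(* Max is used only in finite dimension, where the set of dimensions is finite. *)
definition alpha :: nat where
  "alpha = Max (dim ` {A. abelian_subalgebra A})"

definition rentschler_property :: bool where
  "rentschler_property \<longleftrightarrow> of_nat alpha \<ge> magic_number - 1"

end

(* Finite-dimensionality is stated explicitly because dim is 0 for
   infinite-dimensional subspaces. *)
locale fin_dim_lie_algebra = lie_algebra +
  assumes finite_dimensional: "\<exists>B. finite B \<and> span B = UNIV"

end

theory Submission
  imports Defs
begin

text \<open>
  Write \<open>n\<close>, \<open>z\<close>, \<open>d\<close>, \<open>i\<close> for the dimensions of \<open>L\<close>, of its center \<open>Z\<close> and of its derived
  algebra, and for the index. Rentschler's property is the inequality \<open>n + i \<le> 2 \<alpha> + 2\<close>.
  Being metabelian gives \<open>2 \<le> d \<le> z \<le> i\<close>, so \<open>n \<le> 9\<close> forces \<open>n - i \<le> 7\<close>; and \<open>n - i\<close> is even,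
  being the rank of an alternating form. Call a functional \<open>\<xi>\<close> regular if its stabilizer \<open>L(\<xi>)\<close>
  attains the index. The rest of the argument produces abelian subalgebras that are large enough
  for each possible value of \<open>n - i\<close>.

  \<^item> \<open>n - i \<le> 2\<close>: the stabilizer of a regular functional is abelian (\<open>stabilizer_abelian\<close>), hence
    \<open>\<alpha> \<ge> i\<close>. Indeed the rank of the form \<open>\<xi>([x, y])\<close> is locally constant at a regular \<open>\<xi>\<close>, and the
    tangent directions of the variety of forms of a given rank vanish on the radical.

  \<^item> \<open>n - i = 6\<close>: start from \<open>Z\<close> and adjoin commuting elements one at a time. Each adjoined element
    costs at most \<open>d\<close> dimensions of the centralizer, and there is room for enough steps
    (\<open>alpha_greedy\<close>).

  \<^item> \<open>n - i = 4\<close>: one more dimension than \<open>i\<close> is needed. An element of \<open>L(\<xi>)\<close> has its brackets in the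
    kernel of \<open>\<xi>\<close> on the derived algebra, so it costs only \<open>d - 1\<close> dimensions; the same count shows
    that \<open>L(\<xi>)\<close> is centralized by something outside it (\<open>alpha_extend_stabilizer\<close>), except when
    \<open>n = z + 6\<close>, \<open>i = z + 2\<close> and \<open>d = 3\<close>.

  In the exceptional case there are three regular functionals \<open>a\<close>, \<open>b\<close>, \<open>c\<close> that together are injective
  on the derived algebra. If no abelian subalgebra had dimension \<open>i + 1\<close>, the three stabilizers would
  intersect pairwise in \<open>Z\<close> and \<open>L / Z\<close> would be the direct sum of the three planes \<open>L(a) / Z\<close>,
  \<open>L(b) / Z\<close>, \<open>L(c) / Z\<close>. An element \<open>p + q + r\<close> of the stabilizer of \<open>a + b + c\<close>, split along this sum,
  satisfies \<open>c([p, q]) = a([q, r]) = b([r, p])\<close>, and these are the only obstructions to \<open>p\<close>, \<open>q\<close>, \<open>r\<close>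
  commuting. This common value is a quadratic form on a space that has dimension at least two
  modulo \<open>Z\<close>, so over an algebraically closed field it vanishes at some point outside \<open>Z\<close>. There
  \<open>p\<close>, \<open>q\<close>, \<open>r\<close> and \<open>Z\<close> span an abelian subalgebra of dimension \<open>z + 3 = i + 1\<close>
  (\<open>no_extremal_triple\<close>).
\<close>

section \<open>Kernels in pencils of linear maps\<close>

context finite_dimensional_vector_space
begin

lemma linear_intro:
  assumes "\<And>x y. f (x + y) = f x + f y" "\<And>c x. f (scale c x) = scale c (f x)"
  shows "Vector_Spaces.linear scale scale f"
  using assms vector_space_axioms by (simp add: Vector_Spaces.linear_iff)

lemma functional_intro:
  assumes "\<And>x y. f (x + y) = f x + f y" "\<And>c x. f (scale c x) = c * f x"
  shows "Vector_Spaces.linear scale (*) f"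
proof -
  have "vector_space ((*) :: 'a \<Rightarrow> 'a \<Rightarrow> 'a)"
    by unfold_locales (simp_all add: algebra_simps)
  then show ?thesis
    using assms vector_space_axioms by (simp add: Vector_Spaces.linear_iff)
qed

lemma functional_separating:
  assumes "subspace E" "x \<notin> E"
  obtains \<phi> where "Vector_Spaces.linear scale (*) \<phi>" "\<phi> x = 1" "\<And>e. e \<in> E \<Longrightarrow> \<phi> e = 0"
proof -
  interpret K: vector_space "(*) :: 'a \<Rightarrow> 'a \<Rightarrow> 'a"
    by unfold_locales (simp_all add: algebra_simps)
  interpret VP: vector_space_pair scale "(*)" ..
  obtain B where B: "B \<subseteq> E" "independent B" "span B = E"
    using basis_subspace_exists[OF assms(1)] by metis
  have xB: "x \<notin> span B" using B assms by simp
  then have ind: "independent (insert x B)"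
    using B by (simp add: independent_insertI)
  obtain \<phi> where \<phi>: "Vector_Spaces.linear scale (*) \<phi>"
      "\<forall>b\<in>insert x B. \<phi> b = (if b = x then 1 else 0)"
    using VP.linear_independent_extend[OF ind, of "\<lambda>b. if b = x then 1 else 0"] by blast
  have "\<phi> b = 0" if "b \<in> B" for b
    using \<phi>(2) that xB span_base by (metis insert_iff)
  then have "\<phi> e = 0" if "e \<in> E" for e
    using VP.linear_eq_0_on_span[OF \<phi>(1)] B that by blast
  then show thesis using that \<phi> by simp
qed

lemma dim_kernel_functional:
  assumes S: "subspace S" and f: "Vector_Spaces.linear scale (*) f"
  shows "dim S \<le> dim {x \<in> S. f x = 0} + 1"
proof (cases "\<exists>u\<in>S. f u \<noteq> 0")
  case True
  interpret F: Vector_Spaces.linear scale "(*)" f by fact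
  from True obtain u where u: "u \<in> S" "f u \<noteq> 0" by blast
  let ?K = "{x \<in> S. f x = 0}"
  have "v \<in> span (insert u ?K)" if "v \<in> S" for v
  proof -
    have "v - scale (f v / f u) u \<in> ?K"
      using that u S by (simp add: F.diff F.scale subspace_diff subspace_scale)
    then show ?thesis
      by (intro iffD2[OF span_breakdown_eq] exI span_base)
  qed
  then have "dim S \<le> dim (insert u ?K)" by (intro dim_mono) blast
  then show ?thesis by (simp add: dim_insert split: if_splits)
next
  case False
  then have "{x \<in> S. f x = 0} = S" by blast
  then show ?thesis by simp
qed

lemma dim_add_disjoint_le:
  assumes "subspace E" "subspace K" "E \<inter> K \<subseteq> {0}"
  shows "dim E + dim K \<le> dim (UNIV :: 'b set)"
proof -
  have "dim (E \<inter> K) = 0" using assms dim_eq_0 by blast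
  then show ?thesis
    using dim_sums_Int[OF assms(1,2)] dim_subset[OF subset_UNIV, of "{x + y |x y. x \<in> E \<and> y \<in> K}"] by linarith
qed

lemma sum_mem: "x \<in> A \<Longrightarrow> y \<in> B \<Longrightarrow> x + y \<in> {x + y |x y. x \<in> A \<and> y \<in> B}"
  by blast

text \<open>
  The complement is the image of a right inverse of \<open>f\<close> on \<open>f ` S\<close>, which is why \<open>f\<close> is injective
  on it; this is rank-nullity without choosing bases.
\<close>

lemma kernel_complement:
  assumes S: "subspace S" and f: "Vector_Spaces.linear scale scale f"
  obtains E where "subspace E" "E \<subseteq> S" "\<And>v. v \<in> E \<Longrightarrow> f v = 0 \<Longrightarrow> v = 0"
    "dim S \<le> dim E + dim {x \<in> S. f x = 0}" "dim E \<le> dim (f ` S)"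
proof -
  interpret VP: finite_dimensional_vector_space_pair scale Basis scale Basis by unfold_locales
  interpret F: Vector_Spaces.linear scale scale f by fact
  let ?K = "{x \<in> S. f x = 0}"
  obtain g where g: "g ` UNIV \<subseteq> S" "Vector_Spaces.linear scale scale g" "\<forall>v\<in>f ` S. f (g v) = v"
    using VP.linear_exists_right_inverse_on[OF f S] by blast
  interpret G: Vector_Spaces.linear scale scale g by fact
  let ?E = "g ` f ` S"
  have E: "subspace ?E" using S by (intro G.subspace_image F.subspace_image)
  have K: "subspace ?K" using S
    by (auto simp: subspace_def F.add F.scale F.zero)
  have sub: "?E \<subseteq> S" using g(1) by auto
  have inj: "v = 0" if "v \<in> ?E" "f v = 0" for v
    using that g(3) by (auto simp: G.zero)
  have "S \<subseteq> {x + y |x y. x \<in> ?E \<and> y \<in> ?K}"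
  proof
    fix v assume v: "v \<in> S"
    have "v - g (f v) \<in> ?K"
      using v g S by (auto simp: F.diff intro!: subspace_diff)
    then have "g (f v) + (v - g (f v)) \<in> {x + y |x y. x \<in> ?E \<and> y \<in> ?K}"
      using v sum_mem[of "g (f v)" ?E "v - g (f v)" ?K] by blast
    then show "v \<in> {x + y |x y. x \<in> ?E \<and> y \<in> ?K}" by simp
  qed
  then have "dim S \<le> dim ?E + dim ?K"
    using dim_sums_Int[OF E K] dim_subset[of S "{x + y |x y. x \<in> ?E \<and> y \<in> ?K}"] by linarith
  moreover have "dim ?E \<le> dim (f ` S)" using VP.dim_image_le g(2) by blast
  ultimately show thesis by (intro that[OF E sub inj])
qed

lemma dim_le_kernel_plus_range:
  assumes "subspace S" "Vector_Spaces.linear scale scale f" "f ` S \<subseteq> T"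
  shows "dim S \<le> dim {x \<in> S. f x = 0} + dim T"
proof -
  obtain E where "dim S \<le> dim E + dim {x \<in> S. f x = 0}" "dim E \<le> dim (f ` S)"
    using kernel_complement[OF assms(1,2)] .
  then show ?thesis using dim_subset[OF assms(3)] by linarith
qed

lemma kernel_complement_UNIV:
  assumes f: "Vector_Spaces.linear scale scale f"
  shows "\<exists>E. subspace E \<and> (\<forall>v\<in>E. f v = 0 \<longrightarrow> v = 0)
    \<and> dim (UNIV :: 'b set) \<le> dim E + dim {v. f v = 0}"
proof (rule kernel_complement[OF subspace_UNIV f])
  fix E assume "subspace E" "\<And>v. v \<in> E \<Longrightarrow> f v = 0 \<Longrightarrow> v = 0"
    "dim (UNIV :: 'b set) \<le> dim E + dim {v \<in> UNIV. f v = 0}"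
  then show ?thesis by (intro exI[of _ E]) simp
qed

lemma linear_pencil:
  assumes "Vector_Spaces.linear scale scale F0" "Vector_Spaces.linear scale scale F1"
  shows "Vector_Spaces.linear scale scale (\<lambda>v. F0 v + scale t (F1 v))"
proof -
  interpret F0: Vector_Spaces.linear scale scale F0 by fact
  interpret F1: Vector_Spaces.linear scale scale F1 by fact
  show ?thesis
    by (rule linear_intro) (simp_all add: F0.add F0.scale F1.add F1.scale algebra_simps)
qed

lemma subspace_kernel_linear:
  assumes "Vector_Spaces.linear scale scale F"
  shows "subspace {v. F v = 0}"
proof -
  interpret F: Vector_Spaces.linear scale scale F by fact
  show ?thesis by (rule F.subspace_kernel)
qed

text \<open>
  A bad \<open>t\<close> is nonzero and \<open>- 1 / t\<close> is then an eigenvalue of \<open>T\<close>. Eigenvectors for distinct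
  eigenvalues are independent, so there are at most as many bad \<open>t\<close> as dimensions.
\<close>

lemma finite_singular_pencil:
  assumes T: "Vector_Spaces.linear scale scale T"
  shows "finite {t. \<exists>v. v \<noteq> 0 \<and> v + scale t (T v) = 0}" (is "finite ?Z")
proof (rule ccontr)
  assume inf: "infinite ?Z"
  interpret T: Vector_Spaces.linear scale scale T by fact
  have "\<forall>t\<in>?Z. \<exists>v. v \<noteq> 0 \<and> v + scale t (T v) = 0" by blast
  then have "\<exists>v. \<forall>t\<in>?Z. v t \<noteq> 0 \<and> v t + scale t (T (v t)) = 0" by (rule bchoice)
  then obtain v where v: "\<And>t. t \<in> ?Z \<Longrightarrow> v t \<noteq> 0 \<and> v t + scale t (T (v t)) = 0" by blast
  have indep: "\<forall>c. (\<Sum>a\<in>A. scale (c a) (v a)) = 0 \<longrightarrow> (\<forall>a\<in>A. c a = 0)"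
    if "finite A" "A \<subseteq> ?Z" for A
    using that
  proof (induction A rule: finite_induct)
    case (insert s A)
    show ?case
    proof (intro allI impI)
      fix c assume c: "(\<Sum>a\<in>insert s A. scale (c a) (v a)) = 0"
      \<comment> \<open>applying \<open>1 + s T\<close> annihilates \<open>v s\<close> and multiplies every other \<open>v a\<close> by a nonzero factor\<close>
      have ev: "v a + scale s (T (v a)) = scale (1 - s / a) (v a)" if "a \<in> insert s A" for a
      proof -
        have a: "v a \<noteq> 0" "v a + scale a (T (v a)) = 0" using v insert.prems that by blast+
        then have "a \<noteq> 0" by auto
        have "scale a (T (v a)) = - v a" using a by (simp add: add_eq_0_iff)
        then have "scale (s / a) (- v a) = scale (s / a) (scale a (T (v a)))" by simp
        also have "\<dots> = scale s (T (v a))" using \<open>a \<noteq> 0\<close> by simp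
        finally have "scale s (T (v a)) = - scale (s / a) (v a)" by simp
        then show ?thesis by (simp add: scale_left_diff_distrib)
      qed
      have "0 = (\<Sum>a\<in>insert s A. scale (c a) (v a)) + scale s (T (\<Sum>a\<in>insert s A. scale (c a) (v a)))"
        by (simp only: c T.zero scale_zero_right add_0)
      also have "\<dots> = (\<Sum>a\<in>insert s A. scale (c a) (v a + scale s (T (v a))))"
        by (simp only: T.sum T.scale scale_sum_right sum.distrib scale_right_distrib
            scale_left_commute[of s])
      also have "\<dots> = (\<Sum>a\<in>insert s A. scale (c a * (1 - s / a)) (v a))"
        by (intro sum.cong refl) (simp only: ev scale_scale)
      also have "\<dots> = (\<Sum>a\<in>A. scale (c a * (1 - s / a)) (v a))"
      proof -
        have "scale (c s * (1 - s / s)) (v s) = 0"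
        proof (cases "s = 0")
          case True
          then show ?thesis using v[of s] insert.prems by auto
        qed simp
        then show ?thesis using insert.hyps by simp
      qed
      finally have "(\<Sum>a\<in>A. scale (c a * (1 - s / a)) (v a)) = 0" by simp
      moreover have "\<forall>c. (\<Sum>a\<in>A. scale (c a) (v a)) = 0 \<longrightarrow> (\<forall>a\<in>A. c a = 0)"
        using insert.IH insert.prems by simp
      from spec[OF this, of "\<lambda>a. c a * (1 - s / a)"]
      have "(\<Sum>a\<in>A. scale (c a * (1 - s / a)) (v a)) = 0 \<longrightarrow> (\<forall>a\<in>A. c a * (1 - s / a) = 0)" .
      ultimately have "\<forall>a\<in>A. c a * (1 - s / a) = 0" by (rule rev_mp)
      moreover have "1 - s / a \<noteq> 0" if "a \<in> A" for a
      proof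
        assume "1 - s / a = 0"
        then have "a = s" by (cases "a = 0") (auto simp: field_simps)
        then show False using that insert.hyps by blast
      qed
      ultimately have cA: "\<forall>a\<in>A. c a = 0" by auto
      then have "scale (c s) (v s) = 0" using c insert.hyps by simp
      then have "c s = 0" using v[of s] insert.prems by auto
      then show "\<forall>a\<in>insert s A. c a = 0" using cA by blast
    qed
  qed simp
  obtain A where A: "finite A" "card A = Suc (card Basis)" "A \<subseteq> ?Z"
    using infinite_arbitrarily_large[OF inf, of "Suc (card Basis)"] by (elim exE conjE)
  have inj: "inj_on v A"
  proof (rule inj_onI, rule ccontr)
    fix a b assume ab: "a \<in> A" "b \<in> A" "v a = v b" "a \<noteq> b"
    have "{a, b} \<subseteq> ?Z" using ab(1,2) A(3) by blast
    then have "\<forall>c. (\<Sum>x\<in>{a,b}. scale (c x) (v x)) = 0 \<longrightarrow> (\<forall>x\<in>{a,b}. c x = 0)"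
      by (intro indep) auto
    from spec[OF this, of "\<lambda>x. if x = a then 1 else -1"] show False using ab(3,4) by simp
  qed
  have "independent (v ` A)"
  proof (rule independent_if_scalars_zero)
    fix f x assume f: "(\<Sum>x\<in>v ` A. scale (f x) x) = 0" and x: "x \<in> v ` A"
    have "(\<Sum>a\<in>A. scale (f (v a)) (v a)) = 0" using f by (simp add: sum.reindex[OF inj])
    then have "\<forall>a\<in>A. f (v a) = 0"
      using spec[OF indep[OF A(1,3)], of "\<lambda>a. f (v a)"] by (rule rev_mp)
    then show "f x = 0" using x by blast
  qed (use A in simp)
  then have "card (v ` A) \<le> card Basis"
    using independent_card_le_dim[of "v ` A" UNIV] by simp
  then show False using A inj by (simp add: card_image)
qed

text \<open>
  Composing with a left inverse of \<open>F0\<close> on \<open>E\<close> turns the pencil into \<open>1 + t T\<close>.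
\<close>

lemma finite_noninjective_pencil:
  assumes F0: "Vector_Spaces.linear scale scale F0" and F1: "Vector_Spaces.linear scale scale F1"
    and E: "subspace E" and inj: "\<And>v. v \<in> E \<Longrightarrow> F0 v = 0 \<Longrightarrow> v = 0"
  shows "finite {t. \<exists>v\<in>E. v \<noteq> 0 \<and> F0 v + scale t (F1 v) = 0}"
proof -
  interpret VP: finite_dimensional_vector_space_pair scale Basis scale Basis by unfold_locales
  interpret F0: Vector_Spaces.linear scale scale F0 by fact
  have "inj_on F0 E"
    using VP.linear_inj_on_iff_eq_0[OF F0 E] inj by blast
  then obtain g where g: "Vector_Spaces.linear scale scale g" "\<forall>v\<in>E. g (F0 v) = v"
    using VP.linear_exists_left_inverse_on[OF F0 E] by blast
  interpret G: Vector_Spaces.linear scale scale g by fact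
  have lin: "Vector_Spaces.linear scale scale (\<lambda>v. g (F1 v))"
    using Vector_Spaces.linear_compose[OF F1 g(1)] by (simp add: o_def)
  have "v + scale t (g (F1 v)) = 0" if "v \<in> E" "F0 v + scale t (F1 v) = 0" for v t
    using that g(2) by (metis G.add G.scale G.zero)
  then show ?thesis
    by (intro finite_subset[OF _ finite_singular_pencil[OF lin]]) blast
qed

text \<open>
  Semicontinuity of the rank: injectivity of \<open>F0\<close> on a complement of its kernel persists for all but
  finitely many \<open>t\<close>, and any subspace on which a map is injective bounds the dimension of its kernel.
\<close>

lemma finite_kernel_growth:
  assumes F0: "Vector_Spaces.linear scale scale F0" and F1: "Vector_Spaces.linear scale scale F1"
  shows "finite {t. dim {v. F0 v + scale t (F1 v) = 0} > dim {v. F0 v = 0}}"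
proof -
  interpret F0: Vector_Spaces.linear scale scale F0 by fact
  interpret F1: Vector_Spaces.linear scale scale F1 by fact
  obtain E where E: "subspace E" "\<forall>v\<in>E. F0 v = 0 \<longrightarrow> v = 0"
    "dim (UNIV :: 'b set) \<le> dim E + dim {v. F0 v = 0}"
    using kernel_complement_UNIV[OF F0] by blast
  then have inj: "\<And>v. v \<in> E \<Longrightarrow> F0 v = 0 \<Longrightarrow> v = 0" by blast
  have "dim {v. F0 v + scale t (F1 v) = 0} \<le> dim {v. F0 v = 0}"
    if "\<not> (\<exists>v\<in>E. v \<noteq> 0 \<and> F0 v + scale t (F1 v) = 0)" for t
  proof -
    have "subspace {v. F0 v + scale t (F1 v) = 0}"
      by (intro subspace_kernel_linear linear_pencil F0 F1)
    then have "dim E + dim {v. F0 v + scale t (F1 v) = 0} \<le> dim (UNIV :: 'b set)"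
      using that by (intro dim_add_disjoint_le E) auto
    then show ?thesis using E(3) by simp
  qed
  then show ?thesis
    by (intro finite_subset[OF _ finite_noninjective_pencil[OF F0 F1 E(1) inj]]) (auto simp: not_le[symmetric])
qed

text \<open>
  The tangent space, at \<open>A0\<close>, to the variety of maps of the same rank consists of the maps that send
  the kernel of \<open>A0\<close> into its range. Suppose \<open>A1 x\<close> were outside the range. On \<open>E + \<langle>x\<rangle>\<close>, with \<open>E\<close> a
  complement of the kernel, rescale the \<open>x\<close>-direction of \<open>A0 + t A1\<close> by \<open>1 / t\<close>: the rescaled map
  extends to \<open>t = 0\<close>, where it is \<open>A0\<close> on \<open>E\<close> and sends \<open>x\<close> to \<open>A1 x\<close>, hence is injective. So
  \<open>A0 + t A1\<close> is injective on \<open>E + \<langle>x\<rangle>\<close> for some \<open>t \<noteq> 0\<close>, and its kernel is smaller than that of \<open>A0\<close>.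
\<close>

lemma constant_rank_tangent:
  assumes inf: "infinite (UNIV :: 'a set)"
    and A0: "Vector_Spaces.linear scale scale A0" and A1: "Vector_Spaces.linear scale scale A1"
    and min: "\<And>t. dim {v. A0 v = 0} \<le> dim {v. A0 v + scale t (A1 v) = 0}"
    and x: "A0 x = 0"
  shows "A1 x \<in> range A0"
proof (rule ccontr)
  assume nr: "A1 x \<notin> range A0"
  interpret A0: Vector_Spaces.linear scale scale A0 by fact
  interpret A1: Vector_Spaces.linear scale scale A1 by fact
  have R: "subspace (range A0)" by (intro A0.subspace_image subspace_UNIV)
  obtain E where E: "subspace E" "\<forall>v\<in>E. A0 v = 0 \<longrightarrow> v = 0"
    "dim (UNIV :: 'b set) \<le> dim E + dim {v. A0 v = 0}"
    using kernel_complement_UNIV[OF A0] by blast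
  then have inj: "\<And>v. v \<in> E \<Longrightarrow> A0 v = 0 \<Longrightarrow> v = 0" by blast
  have x0: "x \<noteq> 0" using nr R subspace_0 by (auto simp: A1.zero)
  then have xE: "x \<notin> E" using E(2) x by blast
  obtain \<phi> where \<phi>: "Vector_Spaces.linear scale (*) \<phi>" "\<phi> x = 1" "\<And>e. e \<in> E \<Longrightarrow> \<phi> e = 0"
    using functional_separating[OF E(1) xE] by blast
  interpret \<phi>: Vector_Spaces.linear scale "(*)" \<phi> by fact
  define F0 where "F0 v = A0 v + scale (\<phi> v) (A1 x)" for v
  define F1 where "F1 v = A1 v - scale (\<phi> v) (A1 x)" for v
  let ?E = "span (insert x E)"
  have F0: "Vector_Spaces.linear scale scale F0" unfolding F0_def
    by (rule linear_intro)
      (simp_all add: A0.add A0.scale \<phi>.add \<phi>.scale algebra_simps)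
  have F1: "Vector_Spaces.linear scale scale F1" unfolding F1_def
    by (rule linear_intro)
      (simp_all add: A1.add A1.scale \<phi>.add \<phi>.scale algebra_simps)
  have dec: "\<exists>e\<in>E. \<exists>s. v = e + scale s x" if "v \<in> ?E" for v
    using that span_breakdown_eq[of v x E] E(1) span_eq_iff[of E]
    by (metis diff_add_cancel)
  have inj': "v = 0" if v: "v \<in> ?E" "F0 v = 0" for v
  proof -
    obtain e s where e: "e \<in> E" "v = e + scale s x" using dec[OF v(1)] by blast
    have *: "A0 e + scale s (A1 x) = 0"
      using v(2) e x \<phi> by (simp add: F0_def A0.add A0.scale \<phi>.add \<phi>.scale)
    have "s = 0"
    proof (rule ccontr)
      assume "s \<noteq> 0"
      have "scale s (A1 x) = - A0 e" using * by (simp add: eq_neg_iff_add_eq_0 add.commute)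
      then have "scale (1/s) (scale s (A1 x)) = A0 (scale (-1/s) e)"
        by (simp add: A0.scale A0.neg)
      then have "A1 x = A0 (scale (-1/s) e)" using \<open>s \<noteq> 0\<close> by simp
      then show False using nr by blast
    qed
    then show ?thesis using * E(2) e by simp
  qed
  have "finite ({t. \<exists>v\<in>?E. v \<noteq> 0 \<and> F0 v + scale t (F1 v) = 0} \<union> {0})"
    using finite_noninjective_pencil[OF F0 F1 subspace_span inj'] by simp
  from ex_new_if_finite[OF inf this]
  obtain t where "t \<notin> {t. \<exists>v\<in>?E. v \<noteq> 0 \<and> F0 v + scale t (F1 v) = 0} \<union> {0}" by (elim exE)
  then have t0: "t \<noteq> 0" and t: "w \<in> ?E \<Longrightarrow> F0 w + scale t (F1 w) = 0 \<Longrightarrow> w = 0" for w by auto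
  have "v = 0" if v: "v \<in> ?E" "A0 v + scale t (A1 v) = 0" for v
  proof -
    obtain e s where e: "e \<in> E" "v = e + scale s x" using dec[OF v(1)] by blast
    \<comment> \<open>undoes the rescaling of the \<open>x\<close>-direction\<close>
    let ?w = "e + scale (t * s) x"
    have eq: "F0 ?w + scale t (F1 ?w) = A0 v + scale t (A1 v)"
      using e x \<phi> by (simp add: F0_def F1_def A0.add A0.scale A1.add A1.scale \<phi>.add \<phi>.scale algebra_simps)
    have "?w \<in> ?E" using e(1)
      by (intro span_add span_scale span_base) simp_all
    then have w: "?w = 0" by (rule t[OF _ trans[OF eq v(2)]])
    then have "\<phi> ?w = 0" by (simp add: \<phi>.zero)
    then have "s = 0" using e \<phi> t0 by (simp add: \<phi>.add \<phi>.scale)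
    then show ?thesis using w e by simp
  qed
  moreover have "subspace {v. A0 v + scale t (A1 v) = 0}"
    by (intro subspace_kernel_linear linear_pencil A0 A1)
  ultimately have "dim ?E + dim {v. A0 v + scale t (A1 v) = 0} \<le> dim (UNIV :: 'b set)"
    by (intro dim_add_disjoint_le) auto
  moreover have "dim ?E = dim E + 1"
    using xE iffD2[OF span_eq_iff E(1)] by (simp only: dim_span dim_insert) simp
  ultimately show False using E(3) min[of t] by linarith
qed

section \<open>Alternating forms\<close>

text \<open>
  Splitting off a hyperbolic plane lowers the dimension by two and keeps the radical.
\<close>

lemma even_rank_alternating:
  fixes w :: "'b \<Rightarrow> 'b \<Rightarrow> 'a"
  assumes wr: "\<And>x. Vector_Spaces.linear scale (*) (w x)"
    and wl: "\<And>y. Vector_Spaces.linear scale (*) (\<lambda>x. w x y)"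
    and alt: "\<And>x. w x x = 0"
    and S: "subspace S"
  shows "even (dim S + dim {x \<in> S. \<forall>y\<in>S. w x y = 0})"
  using S
proof (induction "dim S" arbitrary: S rule: less_induct)
  case less
  note Sub = less.prems
  have radd: "w x (y + z) = w x y + w x z" and rsc: "w x (scale c y) = c * w x y" for x y z c
    using wr by (simp_all add: Vector_Spaces.linear_iff)
  have ladd: "w (y + z) x = w y x + w z x" and lsc: "w (scale c y) x = c * w y x" for x y z c
    using wl by (simp_all add: Vector_Spaces.linear_iff)
  have zl: "w 0 y = 0" for y
    using lsc[of 0 0 y] by simp
  have anti: "w y x = - w x y" for x y
    using alt[of "x + y"] alt[of x] alt[of y] unfolding radd ladd
    by (simp add: eq_neg_iff_add_eq_0 add.commute)
  show ?case
  proof (cases "\<forall>x\<in>S. \<forall>y\<in>S. w x y = 0")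
    case True
    then have "{x \<in> S. \<forall>y\<in>S. w x y = 0} = S" by blast
    then show ?thesis by simp
  next
    case False
    then obtain x y where xy: "x \<in> S" "y \<in> S" "w x y \<noteq> 0" by blast
    let ?T = "{s \<in> S. w s x = 0 \<and> w s y = 0}"
    have T: "subspace ?T"
      using Sub by (auto simp: subspace_def ladd lsc zl)
    have spT: "span ?T = ?T" using T by (simp only: span_eq_iff)
    have yT: "y \<notin> span ?T" unfolding spT using xy anti[of x y] by simp
    have xT: "x \<notin> span (insert y ?T)"
    proof
      assume "x \<in> span (insert y ?T)"
      from iffD1[OF span_breakdown_eq this]
      obtain c where "x - scale c y \<in> span ?T" by (elim exE)
      then have "x - scale c y \<in> ?T" unfolding spT .
      then have "w ((x - scale c y) + scale c y) y = 0"
        by (subst ladd) (simp add: lsc alt)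
      then show False using xy by simp
    qed
    have sp: "\<exists>t\<in>?T. \<exists>c d. s = t + scale c x + scale d y" if "s \<in> S" for s
    proof -
      \<comment> \<open>the projection of \<open>s\<close> to the hyperbolic plane spanned by \<open>x\<close> and \<open>y\<close>\<close>
      let ?c = "w s y / w x y" and ?d = "- (w s x / w x y)"
      have "s - scale ?c x - scale ?d y \<in> ?T"
      proof -
        have eq: "s - scale ?c x - scale ?d y = s + scale (- ?c) x + scale (- ?d) y"
          by (simp add: algebra_simps)
        have "s + scale (- ?c) x + scale (- ?d) y \<in> S"
          using that xy Sub by (intro subspace_add subspace_scale)
        moreover have "w (s + scale (- ?c) x + scale (- ?d) y) x = 0"
          unfolding ladd lsc using xy by (simp add: alt anti[of y x])
        moreover have "w (s + scale (- ?c) x + scale (- ?d) y) y = 0"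
          unfolding ladd lsc using xy by (simp add: alt)
        ultimately show ?thesis unfolding eq by simp
      qed
      moreover have "s = (s - scale ?c x - scale ?d y) + scale ?c x + scale ?d y"
        by (simp add: algebra_simps)
      ultimately show ?thesis by (intro bexI exI)
    qed
    have "span (insert x (insert y ?T)) = S"
    proof
      show "span (insert x (insert y ?T)) \<subseteq> S"
        using xy Sub by (intro span_minimal) auto
      show "S \<subseteq> span (insert x (insert y ?T))"
      proof
        fix s assume "s \<in> S"
        from sp[OF this] obtain t c d where "t \<in> ?T" "s = t + scale c x + scale d y"
          by (elim bexE exE)
        then show "s \<in> span (insert x (insert y ?T))"
          by (simp only:) (intro span_add span_scale span_base insertI1 insertI2)
      qed
    qed
    from arg_cong[OF this, of dim] have "dim S = dim (insert x (insert y ?T))"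
      by (simp only: dim_span)
    also have "\<dots> = dim ?T + 2" using xT yT by (simp only: dim_insert if_False one_add_one add.assoc)
    finally have dimS: "dim S = dim ?T + 2" .
    have rad: "{s \<in> S. \<forall>u\<in>S. w s u = 0} = {s \<in> ?T. \<forall>u\<in>?T. w s u = 0}" (is "?A = ?B")
    proof
      show "?A \<subseteq> ?B" using xy by auto
      show "?B \<subseteq> ?A"
      proof
        fix s assume s: "s \<in> ?B"
        have "w s u = 0" if "u \<in> S" for u
        proof -
          obtain t c d where "t \<in> ?T" "u = t + scale c x + scale d y"
            using sp[OF \<open>u \<in> S\<close>] by (elim bexE exE)
          then show ?thesis using s by (simp add: radd rsc)
        qed
        then show "s \<in> ?A" using s by blast
      qed
    qed
    have "dim ?T < dim S" using dimS by linarith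
    from less.hyps[OF this T]
    have ev: "even (dim ?T + dim {s \<in> ?T. \<forall>u\<in>?T. w s u = 0})" .
    have "even (k + 2 + m)" if "even (k + m)" for k m :: nat using that by simp
    from this[OF ev] show ?thesis by (simp only: rad dimS)
  qed
qed

end

section \<open>Stabilizers of functionals and the index\<close>

text \<open>
  A basis is carried along only to make the theory of finite-dimensional vector spaces applicable.
\<close>

locale lie_algebra_with_basis =
  lie_algebra scale bracket + finite_dimensional_vector_space scale Basis
  for scale :: "'k::{alg_closed_field, field_char_0} \<Rightarrow> 'l::ab_group_add \<Rightarrow> 'l"
    and bracket :: "'l \<Rightarrow> 'l \<Rightarrow> 'l" and Basis :: "'l set"
begin

lemma bracket_add_left: "bracket (x + y) z = bracket x z + bracket y z"
  and bracket_scale_left: "bracket (scale c x) z = scale c (bracket x z)"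
  using linear_left[of z] by (simp_all add: Vector_Spaces.linear_iff)

lemma bracket_add_right: "bracket z (x + y) = bracket z x + bracket z y"
  and bracket_scale_right: "bracket z (scale c x) = scale c (bracket z x)"
  using linear_right[of z] by (simp_all add: Vector_Spaces.linear_iff)

lemma bracket_zero_left: "bracket 0 x = 0" and bracket_zero_right: "bracket x 0 = 0"
  using bracket_scale_left[of 0 0 x] bracket_scale_right[of x 0 0] by simp_all

lemma bracket_anti: "bracket y x = - bracket x y"
  using alternating[of "x + y"] alternating[of x] alternating[of y]
  unfolding bracket_add_left bracket_add_right
  by (simp add: eq_neg_iff_add_eq_0 add.commute)

lemmas bracket_linear = bracket_add_left bracket_scale_left bracket_add_right bracket_scale_right
  bracket_zero_left bracket_zero_right

lemma functional_add: "\<xi> \<in> dual_space \<Longrightarrow> \<xi> (x + y) = \<xi> x + \<xi> y"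
  and functional_scale: "\<xi> \<in> dual_space \<Longrightarrow> \<xi> (scale c x) = c * \<xi> x"
  by (simp_all add: dual_space_def Vector_Spaces.linear_iff)

lemma functional_zero: "\<xi> \<in> dual_space \<Longrightarrow> \<xi> 0 = 0"
  using functional_scale[of \<xi> 0 0] by simp

lemma functional_neg: "\<xi> \<in> dual_space \<Longrightarrow> \<xi> (- x) = - \<xi> x"
  using functional_scale[of \<xi> "-1" x] by simp

lemmas functional_linear = functional_add functional_scale functional_zero functional_neg

lemma dual_spaceI:
  assumes "\<And>x y. f (x + y) = f x + f y" "\<And>c x. f (scale c x) = c * f x"
  shows "f \<in> dual_space"
  using functional_intro[OF assms] by (simp add: dual_space_def)

lemma dual_space_pencil:
  assumes "\<xi> \<in> dual_space" "\<eta> \<in> dual_space"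
  shows "(\<lambda>x. \<xi> x + t * \<eta> x) \<in> dual_space"
  by (rule dual_spaceI) (simp_all add: functional_linear assms algebra_simps)

lemma bracket_functional:
  assumes "\<xi> \<in> dual_space"
  shows "(\<lambda>y. \<xi> (bracket x y)) \<in> dual_space" "(\<lambda>y. \<xi> (bracket y x)) \<in> dual_space"
  by (rule dual_spaceI; simp add: functional_linear assms bracket_linear)+

lemma dim_kernel_dual:
  assumes "subspace S" "\<xi> \<in> dual_space"
  shows "dim S \<le> dim {x \<in> S. \<xi> x = 0} + 1"
  using dim_kernel_functional assms by (simp add: dual_space_def)

lemma subspace_kernel_dual:
  assumes "subspace S" "\<xi> \<in> dual_space"
  shows "subspace {x \<in> S. \<xi> x = 0}"
  using assms by (auto simp: subspace_def functional_linear)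

lemma subspace_stabilizer: "\<xi> \<in> dual_space \<Longrightarrow> subspace (stabilizer \<xi>)"
  by (auto simp: subspace_def stabilizer_def bracket_linear functional_linear)

lemma subspace_center: "subspace center"
  by (auto simp: subspace_def center_def bracket_linear)

lemma center_bracket: "z \<in> center \<Longrightarrow> bracket z x = 0" "z \<in> center \<Longrightarrow> bracket x z = 0"
  using bracket_anti[of x z] by (auto simp: center_def)

lemma stabilizer_left: "x \<in> stabilizer \<xi> \<Longrightarrow> \<xi> (bracket x y) = 0"
  by (simp add: stabilizer_def)

lemma stabilizer_right: "\<xi> \<in> dual_space \<Longrightarrow> x \<in> stabilizer \<xi> \<Longrightarrow> \<xi> (bracket y x) = 0"
  using bracket_anti[of y x] by (simp add: stabilizer_left functional_neg)

lemma center_subset_stabilizer: "\<xi> \<in> dual_space \<Longrightarrow> center \<subseteq> stabilizer \<xi>"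
  by (auto simp: stabilizer_def center_bracket functional_zero)

lemma subspace_derived: "subspace derived_algebra"
  unfolding derived_algebra_def by (rule subspace_span)

lemma bracket_derived: "bracket x y \<in> derived_algebra"
  unfolding derived_algebra_def by (rule span_base) blast

definition regular :: "('l \<Rightarrow> 'k) \<Rightarrow> bool" where
  "regular \<xi> \<longleftrightarrow> \<xi> \<in> dual_space \<and> dim (stabilizer \<xi>) = index"

lemma regular_dual: "regular \<xi> \<Longrightarrow> \<xi> \<in> dual_space"
  by (simp add: regular_def)

lemma index_le: "\<xi> \<in> dual_space \<Longrightarrow> index \<le> dim (stabilizer \<xi>)"
  unfolding index_def by (rule wellorder_Inf_le1) blast

lemma zero_dual: "(\<lambda>_. 0) \<in> dual_space"
  by (rule dual_spaceI) simp_all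

lemma regular_exists: "\<exists>\<xi>. regular \<xi>"
proof -
  have "index \<in> (\<lambda>\<xi>. dim (stabilizer \<xi>)) ` dual_space"
    unfolding index_def using zero_dual by (intro wellorder_InfI) blast
  then show ?thesis by (auto simp: regular_def)
qed

text \<open>
  A copy of the dual space inside \<open>L\<close>: functionals are turned into vectors, so that the map
  \<open>v \<mapsto> \<xi>([v, _])\<close> becomes an endomorphism of \<open>L\<close>.
\<close>

definition coordinates :: "('l \<Rightarrow> 'k) \<Rightarrow> 'l" where
  "coordinates f = (\<Sum>b\<in>Basis. scale (f b) b)"

lemma coordinates_eq_0:
  assumes f: "f \<in> dual_space" and 0: "coordinates f = 0"
  shows "f y = 0"
proof -
  have f0: "f b = 0" if "b \<in> Basis" for b
    using independentD[OF independent_Basis finite_Basis subset_refl] 0 that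
    by (simp add: coordinates_def)
  have "y \<in> span Basis" by (simp add: span_Basis)
  then show ?thesis
    by (induction rule: span_induct_alt) (simp_all add: functional_linear f f0)
qed

lemma coordinates_pencil:
  "coordinates (\<lambda>x. f x + t * g x) = coordinates f + scale t (coordinates g)"
  by (simp add: coordinates_def scale_left_distrib sum.distrib scale_sum_right)

definition structure_map :: "('l \<Rightarrow> 'k) \<Rightarrow> 'l \<Rightarrow> 'l" where
  "structure_map \<xi> v = coordinates (\<lambda>y. \<xi> (bracket v y))"

lemma structure_map_linear:
  assumes "\<xi> \<in> dual_space"
  shows "Vector_Spaces.linear scale scale (structure_map \<xi>)"
  by (rule linear_intro)
    (simp_all add: structure_map_def coordinates_def bracket_linear functional_linear assms
      scale_left_distrib sum.distrib scale_sum_right)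

lemma structure_map_kernel:
  assumes "\<xi> \<in> dual_space"
  shows "{v. structure_map \<xi> v = 0} = stabilizer \<xi>"
proof -
  have "\<xi> (bracket v y) = 0" if "structure_map \<xi> v = 0" for v y
    using coordinates_eq_0[OF bracket_functional(1)[OF assms]] that by (simp add: structure_map_def)
  moreover have "structure_map \<xi> v = 0" if "v \<in> stabilizer \<xi>" for v
    using that by (simp add: structure_map_def coordinates_def stabilizer_def)
  ultimately show ?thesis by (auto simp: stabilizer_def)
qed

lemma structure_map_pencil:
  "structure_map (\<lambda>x. \<xi> x + t * \<eta> x) v = structure_map \<xi> v + scale t (structure_map \<eta> v)"
  by (simp add: structure_map_def coordinates_pencil)

text \<open>
  If \<open>\<eta>([x, y]) \<noteq> 0\<close>, move \<open>\<xi>\<close> along \<open>\<xi> + t \<eta>\<close>. Since \<open>\<xi>\<close> is regular the kernel of the structure map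
  cannot shrink, so by \<open>constant_rank_tangent\<close> the functional \<open>\<eta>([x, _])\<close> equals \<open>\<xi>([u, _])\<close> for some
  \<open>u\<close>, and the latter vanishes at \<open>y \<in> L(\<xi>)\<close>.
\<close>

lemma stabilizer_abelian:
  assumes \<xi>: "regular \<xi>" and x: "x \<in> stabilizer \<xi>" and y: "y \<in> stabilizer \<xi>"
  shows "bracket x y = 0"
proof (rule ccontr)
  assume "bracket x y \<noteq> 0"
  then have "bracket x y \<notin> {0}" by simp
  from functional_separating[OF subspace_single_0 this]
  obtain \<eta> where \<eta>: "\<eta> \<in> dual_space" "\<eta> (bracket x y) = 1"
    unfolding dual_space_def by blast
  have \<xi>d: "\<xi> \<in> dual_space" using \<xi> by (rule regular_dual)
  have "dim {v. structure_map \<xi> v = 0}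
      \<le> dim {v. structure_map \<xi> v + scale t (structure_map \<eta> v) = 0}" for t
  proof -
    have "(\<lambda>x. \<xi> x + t * \<eta> x) \<in> dual_space" by (rule dual_space_pencil[OF \<xi>d \<eta>(1)])
    from index_le[OF this] structure_map_kernel[OF this] structure_map_kernel[OF \<xi>d] \<xi>
    show ?thesis by (simp add: structure_map_pencil regular_def)
  qed
  moreover have "structure_map \<xi> x = 0"
    using x structure_map_kernel[OF \<xi>d] by blast
  ultimately have "structure_map \<eta> x \<in> range (structure_map \<xi>)"
    by (intro constant_rank_tangent infinite_UNIV_char_0 structure_map_linear \<xi>d \<eta>(1))
  then obtain u where "structure_map \<eta> x = structure_map \<xi> u" by blast
  then have "coordinates (\<lambda>z. \<eta> (bracket x z) + (-1) * \<xi> (bracket u z)) = 0"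
    unfolding coordinates_pencil structure_map_def by simp
  from coordinates_eq_0[OF dual_space_pencil[OF bracket_functional(1)[OF \<eta>(1)]
        bracket_functional(1)[OF \<xi>d]] this]
  have "\<eta> (bracket x y) = \<xi> (bracket u y)" by simp
  then show False using stabilizer_right[OF \<xi>d y] \<eta>(2) by simp
qed

text \<open>
  By \<open>finite_kernel_growth\<close> all but finitely many \<open>t\<close> qualify. This serves to replace \<open>\<eta>\<close> by a regular functional that agrees
  with a nonzero multiple of \<open>\<eta>\<close> wherever \<open>\<xi>\<close> vanishes.
\<close>

lemma regular_pencil:
  assumes \<xi>: "regular \<xi>" and \<eta>: "\<eta> \<in> dual_space"
  obtains t where "t \<noteq> 0" "regular (\<lambda>x. \<xi> x + t * \<eta> x)"
proof -
  have \<xi>d: "\<xi> \<in> dual_space" using \<xi> by (rule regular_dual)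
  let ?bad = "{t. dim {v. structure_map \<xi> v + scale t (structure_map \<eta> v) = 0}
      > dim {v. structure_map \<xi> v = 0}}"
  have "finite (insert 0 ?bad)"
    using finite_kernel_growth[OF structure_map_linear[OF \<xi>d] structure_map_linear[OF \<eta>]] by simp
  from ex_new_if_finite[OF infinite_UNIV_char_0 this]
  obtain t where t: "t \<notin> insert 0 ?bad" by (elim exE)
  have d: "(\<lambda>x. \<xi> x + t * \<eta> x) \<in> dual_space" by (rule dual_space_pencil[OF \<xi>d \<eta>])
  have "dim (stabilizer (\<lambda>x. \<xi> x + t * \<eta> x)) \<le> index"
    using t \<xi> unfolding structure_map_kernel[OF d, symmetric] structure_map_kernel[OF \<xi>d]
    by (simp add: structure_map_pencil regular_def)
  then have "regular (\<lambda>x. \<xi> x + t * \<eta> x)"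
    using index_le[OF d] d by (simp add: regular_def)
  then show thesis using that t by blast
qed

lemma even_dim_plus_index: "even (dim (UNIV :: 'l set) + index)"
proof -
  obtain \<xi> where \<xi>: "regular \<xi>" using regular_exists by blast
  have d: "\<xi> \<in> dual_space" using \<xi> by (rule regular_dual)
  have "even (dim (UNIV :: 'l set) + dim {x \<in> UNIV. \<forall>y\<in>UNIV. \<xi> (bracket x y) = 0})"
    using bracket_functional[OF d] alternating functional_zero[OF d]
    by (intro even_rank_alternating subspace_UNIV) (simp_all add: dual_space_def)
  moreover have "{x \<in> UNIV. \<forall>y\<in>UNIV. \<xi> (bracket x y) = 0} = stabilizer \<xi>"
    by (simp add: stabilizer_def)
  ultimately show ?thesis using \<xi> by (simp only: regular_def)
qed

section \<open>Abelian subalgebras and centralizers\<close>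

lemma abelian_span:
  assumes comm: "\<And>x y. x \<in> S \<Longrightarrow> y \<in> S \<Longrightarrow> bracket x y = 0"
  shows "abelian_subalgebra (span S)"
proof -
  have 1: "bracket x y = 0" if "x \<in> span S" "y \<in> S" for x y
    using that by (induction rule: span_induct_alt) (simp_all add: bracket_linear comm)
  have 2: "bracket x y = 0" if "y \<in> span S" "x \<in> span S" for x y
    using that by (induction rule: span_induct_alt) (simp_all add: bracket_linear 1)
  show ?thesis
    unfolding abelian_subalgebra_def subalgebra_def
    using 2 subspace_span span_zero by auto
qed

lemma abelian_subspace:
  assumes "subspace A" "\<And>x y. x \<in> A \<Longrightarrow> y \<in> A \<Longrightarrow> bracket x y = 0"
  shows "abelian_subalgebra A"
  using abelian_span[of A] assms iffD2[OF span_eq_iff assms(1)] by simp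

lemma dim_le_alpha:
  assumes "abelian_subalgebra A"
  shows "dim A \<le> alpha"
proof -
  have "dim ` {A. abelian_subalgebra A} \<subseteq> {..dimension}"
    using dim_subset_UNIV by blast
  then have "finite (dim ` {A. abelian_subalgebra A})"
    by (rule finite_subset) simp
  then show ?thesis unfolding alpha_def using assms by (intro Max_ge) auto
qed

lemma index_le_alpha: "index \<le> alpha"
proof -
  obtain \<xi> where \<xi>: "regular \<xi>" using regular_exists by blast
  have "abelian_subalgebra (stabilizer \<xi>)"
    using stabilizer_abelian[OF \<xi>] subspace_stabilizer[OF regular_dual[OF \<xi>]]
    by (intro abelian_subspace)
  then show ?thesis using dim_le_alpha \<xi> by (fastforce simp: regular_def)
qed

lemma abelian_extend:
  assumes A: "abelian_subalgebra A"
    and C: "dim A < dim {y. \<forall>x\<in>A. bracket x y = 0}"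
  obtains y where "y \<notin> A" "abelian_subalgebra (span (insert y A))" "dim (span (insert y A)) = dim A + 1"
proof -
  have "\<not> {y. \<forall>x\<in>A. bracket x y = 0} \<subseteq> A" using C dim_subset not_le by blast
  then obtain y where y: "y \<notin> A" "\<And>x. x \<in> A \<Longrightarrow> bracket x y = 0" by blast
  have sA: "span A = A" using A span_eq_iff by (simp add: abelian_subalgebra_def subalgebra_def)
  have "bracket y x = 0" if "x \<in> A" for x using y(2)[OF that] bracket_anti[of y x] by simp
  then have "abelian_subalgebra (span (insert y A))"
    using A y(2) by (intro abelian_span) (auto simp: abelian_subalgebra_def alternating)
  moreover have "dim (span (insert y A)) = dim A + 1"
    using y(1) sA by (simp only: dim_span dim_insert if_False)
  ultimately show thesis using that y by blast
qed

text \<open>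
  Centralizing one more element means passing to the kernel of a linear map into \<open>D\<close>.
\<close>

lemma dim_centralizer:
  assumes "finite S" "\<And>x y. x \<in> S \<Longrightarrow> bracket x y \<in> D"
  shows "dim (UNIV :: 'l set) \<le> dim {y. \<forall>x\<in>S. bracket x y = 0} + card S * dim D"
  using assms
proof (induction S rule: finite_induct)
  case (insert s S)
  let ?C = "{y. \<forall>x\<in>S. bracket x y = 0}"
  have "subspace ?C" by (auto simp: subspace_def bracket_linear)
  then have 1: "dim ?C \<le> dim {y \<in> ?C. bracket s y = 0} + dim D"
    using insert.prems by (intro dim_le_kernel_plus_range linear_right) auto
  have 2: "{y \<in> ?C. bracket s y = 0} = {y. \<forall>x\<in>insert s S. bracket x y = 0}" by blast
  have "dim (UNIV :: 'l set) \<le> dim ?C + card S * dim D"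
    using insert.IH insert.prems by blast
  then have "dim (UNIV :: 'l set)
      \<le> dim {y. \<forall>x\<in>insert s S. bracket x y = 0} + (dim D + card S * dim D)"
    using 1 unfolding 2 by linarith
  moreover have "card (insert s S) = Suc (card S)" using insert.hyps by simp
  ultimately show ?case by (simp only: mult_Suc)
qed simp

lemma centralizer_span_center:
  "{y. \<forall>x\<in>span (center \<union> S). bracket x y = 0} = {y. \<forall>x\<in>S. bracket x y = 0}"
proof -
  have "bracket x y = 0" if "\<forall>x\<in>S. bracket x y = 0" "x \<in> span (center \<union> S)" for x y
    using that(2)
    by (induction rule: span_induct_alt) (use that(1) in \<open>auto simp: bracket_linear center_bracket\<close>)
  moreover have "x \<in> span (center \<union> S)" if "x \<in> S" for x using that span_base by blast
  ultimately show ?thesis by blast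
qed

text \<open>
  As long as the centralizer of the elements chosen so far has larger dimension than the abelian
  subalgebra they span with the center, another element can be adjoined.
\<close>

lemma greedy_abelian:
  assumes "\<And>j. j < k \<Longrightarrow> dim center + j + j * dim derived_algebra < dim (UNIV :: 'l set)"
  shows "\<exists>S. finite S \<and> card S = k \<and> abelian_subalgebra (span (center \<union> S))
    \<and> dim (span (center \<union> S)) = dim center + k"
  using assms
proof (induction k)
  case 0
  have "abelian_subalgebra (span center)" by (intro abelian_span) (rule center_bracket)
  then show ?case by (intro exI[of _ "{}"]) simp
next
  case (Suc k)
  from Suc.IH[OF Suc.prems[OF less_SucI]]
  obtain S where S: "finite S" "card S = k" "abelian_subalgebra (span (center \<union> S))"
    "dim (span (center \<union> S)) = dim center + k" by blast
  have "dim (UNIV :: 'l set) \<le> dim {y. \<forall>x\<in>S. bracket x y = 0} + k * dim derived_algebra"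
    using dim_centralizer[OF S(1) bracket_derived] S(2) by simp
  then have "dim (span (center \<union> S)) < dim {y. \<forall>x\<in>span (center \<union> S). bracket x y = 0}"
    using Suc.prems[of k] S(4) unfolding centralizer_span_center by simp
  from abelian_extend[OF S(3) this]
  obtain y where y: "y \<notin> span (center \<union> S)"
    "abelian_subalgebra (span (insert y (span (center \<union> S))))"
    "dim (span (insert y (span (center \<union> S)))) = dim center + k + 1" unfolding S(4) .
  have eq: "span (insert y (span (center \<union> S))) = span (center \<union> insert y S)"
    by (simp only: span_insert span_span Un_insert_right)
  have "y \<notin> S" using y(1) span_base by blast
  then show ?case using S y unfolding eq by (intro exI[of _ "insert y S"]) simp
qed

lemma span_center_decomposition:
  assumes A: "subspace A" "center \<subseteq> A"
  obtains S where "finite S" "S \<subseteq> A" "A = span (center \<union> S)" "card S + dim center = dim A"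
proof -
  obtain B where B: "finite B" "B \<subseteq> center" "independent B" "span B = center" "card B = dim center"
    using basis_subspace_exists[OF subspace_center] .
  obtain B' where B': "B \<subseteq> B'" "B' \<subseteq> A" "independent B'" "A \<subseteq> span B'"
    using maximal_independent_subset_extend[of B A] B A(2) by blast
  have fin: "finite B'" using B'(3) by (rule finiteI_independent)
  let ?S = "B' - B"
  have "span B' \<subseteq> span (center \<union> ?S)" using B by (intro span_mono) blast
  moreover have "span (center \<union> ?S) \<subseteq> A" using B' A by (intro span_minimal) auto
  ultimately have "A = span (center \<union> ?S)" using B'(4) by blast
  moreover have "card B' = dim A" using B' by (intro basis_card_eq_dim)
  then have "card ?S + dim center = dim A"
    using card_Diff_subset[OF B(1) B'(1)] card_mono[OF fin B'(1)] B(5) by simp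
  ultimately show thesis using that[of ?S] fin B' by blast
qed


section \<open>The exceptional dimensions\<close>

lemma cutting_functional:
  assumes "subspace S"
  obtains \<eta> where "\<eta> \<in> dual_space" "dim {u \<in> S. \<eta> u = 0} \<le> dim S - 1"
proof (cases "S \<subseteq> {0}")
  case True
  then have "dim S = 0" by (simp only: dim_eq_0)
  moreover have "dim {u \<in> S. (\<lambda>_. 0 :: 'k) u = 0} \<le> dim S" by (rule dim_subset) blast
  ultimately have "dim {u \<in> S. (\<lambda>_. 0 :: 'k) u = 0} \<le> dim S - 1" by linarith
  then show thesis using that[OF zero_dual] by blast
next
  case False
  then obtain p where p: "p \<in> S" "p \<notin> {0}" by blast
  obtain \<eta> where "Vector_Spaces.linear scale (*) \<eta>" "\<eta> p = 1"
    using functional_separating[OF subspace_single_0 p(2)] by blast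
  then have \<eta>: "\<eta> \<in> dual_space" "\<eta> p \<noteq> 0" by (simp_all add: dual_space_def)
  let ?K = "{u \<in> S. \<eta> u = 0}"
  have K: "subspace ?K" by (rule subspace_kernel_dual[OF assms \<eta>(1)])
  have "\<not> dim S \<le> dim ?K"
  proof
    assume "dim S \<le> dim ?K"
    then have "?K = S" by (intro subspace_dim_equal K assms) auto
    then show False using p(1) \<eta>(2) by blast
  qed
  then show thesis using that[OF \<eta>(1)] by linarith
qed

lemma derived_kernel_less:
  assumes a: "regular a" and less: "index < dim (UNIV :: 'l set)"
  shows "dim {u \<in> derived_algebra. a u = 0} < dim derived_algebra"
proof (rule ccontr)
  have d: "a \<in> dual_space" using a by (rule regular_dual)
  assume "\<not> dim {u \<in> derived_algebra. a u = 0} < dim derived_algebra"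
  then have "{u \<in> derived_algebra. a u = 0} = derived_algebra"
    by (intro subspace_dim_equal subspace_kernel_dual subspace_derived d) auto
  then have "a (bracket x y) = 0" for x y using bracket_derived[of x y] by blast
  then have "stabilizer a = UNIV" by (auto simp: stabilizer_def)
  then show False using a less by (simp add: regular_def)
qed

text \<open>
  Two functionals \<open>\<beta>\<close>, \<open>\<gamma>\<close> suffice to cut the kernel of \<open>a\<close> on the derived algebra, of dimension at most
  two, down to zero. Adding \<open>a\<close> to suitable nonzero multiples of them makes them regular and keeps
  their zeros in that kernel.
\<close>

lemma regular_separating_triple:
  assumes a: "regular a" and less: "index < dim (UNIV :: 'l set)" and d: "dim derived_algebra \<le> 3"
  obtains b c where "regular b" "regular c"
    "\<And>u. u \<in> derived_algebra \<Longrightarrow> a u = 0 \<Longrightarrow> b u = 0 \<Longrightarrow> c u = 0 \<Longrightarrow> u = 0"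
proof -
  let ?D1 = "{u \<in> derived_algebra. a u = 0}"
  have s1: "subspace ?D1" by (rule subspace_kernel_dual[OF subspace_derived regular_dual[OF a]])
  obtain \<beta> where \<beta>: "\<beta> \<in> dual_space" "dim {u \<in> ?D1. \<beta> u = 0} \<le> dim ?D1 - 1"
    using cutting_functional[OF s1] .
  let ?D2 = "{u \<in> ?D1. \<beta> u = 0}"
  have s2: "subspace ?D2" by (rule subspace_kernel_dual[OF s1 \<beta>(1)])
  obtain \<gamma> where \<gamma>: "\<gamma> \<in> dual_space" "dim {u \<in> ?D2. \<gamma> u = 0} \<le> dim ?D2 - 1"
    using cutting_functional[OF s2] .
  have "dim {u \<in> ?D2. \<gamma> u = 0} = 0"
    using derived_kernel_less[OF a less] d \<beta>(2) \<gamma>(2) by linarith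
  then have sep: "{u \<in> ?D2. \<gamma> u = 0} \<subseteq> {0}" by (simp only: dim_eq_0)
  obtain s where s: "s \<noteq> 0" "regular (\<lambda>x. a x + s * \<beta> x)" using regular_pencil[OF a \<beta>(1)] .
  obtain t where t: "t \<noteq> 0" "regular (\<lambda>x. a x + t * \<gamma> x)" using regular_pencil[OF a \<gamma>(1)] .
  show thesis
  proof (rule that[OF s(2) t(2)])
    fix u assume "u \<in> derived_algebra" "a u = 0" "a u + s * \<beta> u = 0" "a u + t * \<gamma> u = 0"
    then have "u \<in> {u \<in> ?D2. \<gamma> u = 0}" using s(1) t(1) by simp
    then show "u = 0" using sep by blast
  qed
qed

text \<open>
  The situation to be refuted: the exceptional dimensions, a separating triple of regular
  functionals, and no abelian subalgebra larger than the stabilizers. The conditions are symmetric in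
  the three functionals, so that a statement about a triple can be applied to its permutations.
\<close>

definition extremal_triple :: "('l \<Rightarrow> 'k) \<Rightarrow> ('l \<Rightarrow> 'k) \<Rightarrow> ('l \<Rightarrow> 'k) \<Rightarrow> bool" where
  "extremal_triple a b c \<longleftrightarrow> regular a \<and> regular b \<and> regular c \<and>
     (\<forall>u\<in>derived_algebra. a u = 0 \<longrightarrow> b u = 0 \<longrightarrow> c u = 0 \<longrightarrow> u = 0) \<and>
     dim (UNIV :: 'l set) = dim center + 6 \<and> index = dim center + 2 \<and>
     (\<forall>A. abelian_subalgebra A \<longrightarrow> dim A \<le> index)"

lemma extremal_triple_swap: "extremal_triple a b c \<Longrightarrow> extremal_triple b a c"
  and extremal_triple_rotate: "extremal_triple a b c \<Longrightarrow> extremal_triple b c a"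
  unfolding extremal_triple_def by blast+

lemma extremal_tripleD:
  assumes "extremal_triple a b c"
  shows "regular a" "regular b" "regular c" "a \<in> dual_space" "b \<in> dual_space" "c \<in> dual_space"
    "dim (UNIV :: 'l set) = dim center + 6" "index = dim center + 2"
    "\<And>A. abelian_subalgebra A \<Longrightarrow> dim A \<le> index"
    "\<And>x y. a (bracket x y) = 0 \<Longrightarrow> b (bracket x y) = 0 \<Longrightarrow> c (bracket x y) = 0 \<Longrightarrow> bracket x y = 0"
  using assms bracket_derived regular_dual unfolding extremal_triple_def by blast+

text \<open>
  The center, \<open>x\<close> and \<open>x'\<close> span the stabilizer of \<open>a\<close>, so whatever commutes with \<open>x\<close> and \<open>x'\<close>
  centralizes that stabilizer, which is a maximal abelian subalgebra.
\<close>

lemma extremal_partner: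
  assumes ext: "extremal_triple a b c" and x: "x \<in> stabilizer a" "x \<notin> center"
  obtains x' where "x' \<in> stabilizer a"
    "\<And>Y. (\<And>y. y \<in> Y \<Longrightarrow> bracket x y = 0 \<and> bracket x' y = 0) \<Longrightarrow> dim Y \<le> index"
proof -
  note e = extremal_tripleD[OF ext]
  have Ra: "subspace (stabilizer a)" "dim (stabilizer a) = dim center + 2"
    using subspace_stabilizer[OF e(4)] e(1,8) by (simp_all add: regular_def)
  have spc: "span center = center" using subspace_center by (simp only: span_eq_iff)
  have dx: "dim (insert x center) = dim center + 1"
    using x(2) by (simp add: dim_insert spc)
  have "\<not> stabilizer a \<subseteq> span (insert x center)"
  proof
    assume "stabilizer a \<subseteq> span (insert x center)"
    from dim_mono[OF this] show False using Ra(2) dx by simp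
  qed
  then obtain x' where x': "x' \<in> stabilizer a" "x' \<notin> span (insert x center)" by blast
  have "dim (span (insert x' (insert x center))) = dim center + 2"
    using x'(2) dx by (simp add: dim_insert)
  moreover have "span (insert x' (insert x center)) \<subseteq> stabilizer a"
    using x(1) x'(1) center_subset_stabilizer[OF e(4)] Ra(1) by (intro span_minimal) auto
  ultimately have "span (insert x' (insert x center)) = stabilizer a"
    using Ra by (intro subspace_dim_equal subspace_span) simp_all
  then have eq: "span (center \<union> {x, x'}) = stabilizer a"
    by (simp add: insert_commute)
  have "dim Y \<le> index" if Y: "\<And>y. y \<in> Y \<Longrightarrow> bracket x y = 0 \<and> bracket x' y = 0" for Y
  proof (rule ccontr)
    assume "\<not> dim Y \<le> index"
    moreover have "Y \<subseteq> {y. \<forall>u\<in>stabilizer a. bracket u y = 0}"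
      unfolding eq[symmetric] centralizer_span_center using Y by blast
    then have "dim Y \<le> dim {y. \<forall>u\<in>stabilizer a. bracket u y = 0}" by (rule dim_subset)
    ultimately have less: "dim (stabilizer a) < dim {y. \<forall>u\<in>stabilizer a. bracket u y = 0}"
      using e(1) by (simp add: regular_def)
    have "abelian_subalgebra (stabilizer a)"
      using stabilizer_abelian[OF e(1)] Ra(1) by (intro abelian_subspace)
    from abelian_extend[OF this less] obtain y where
      "abelian_subalgebra (span (insert y (stabilizer a)))"
      "dim (span (insert y (stabilizer a))) = dim (stabilizer a) + 1" by blast
    then show False using e(9)[of "span (insert y (stabilizer a))"] Ra(2) e(8) by linarith
  qed
  then show thesis using that x'(1) by blast
qed

text \<open>
  A noncentral \<open>x\<close> in both stabilizers is centralized as soon as \<open>c([x, _])\<close> vanishes, and its partner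
  as soon as \<open>b([x', _])\<close> and \<open>c([x', _])\<close> do: three conditions, leaving dimension \<open>n - 3 = z + 3 > i\<close>.
\<close>

lemma extremal_Int:
  assumes ext: "extremal_triple a b c" and x: "x \<in> stabilizer a" "x \<in> stabilizer b"
  shows "x \<in> center"
proof (rule ccontr)
  assume nz: "x \<notin> center"
  note e = extremal_tripleD[OF ext]
  obtain x' where x': "x' \<in> stabilizer a"
    "\<And>Y. (\<And>y. y \<in> Y \<Longrightarrow> bracket x y = 0 \<and> bracket x' y = 0) \<Longrightarrow> dim Y \<le> index"
    using extremal_partner[OF ext x(1) nz] by blast
  let ?Y1 = "{y \<in> UNIV. c (bracket x y) = 0}"
  let ?Y2 = "{y \<in> ?Y1. b (bracket x' y) = 0}"
  let ?Y3 = "{y \<in> ?Y2. c (bracket x' y) = 0}"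
  have 1: "dim (UNIV :: 'l set) \<le> dim ?Y1 + 1"
    by (intro dim_kernel_dual bracket_functional e(4-6) subspace_UNIV)
  have 2: "dim ?Y1 \<le> dim ?Y2 + 1"
    by (intro dim_kernel_dual subspace_kernel_dual bracket_functional e(4-6) subspace_UNIV)
  have 3: "dim ?Y2 \<le> dim ?Y3 + 1"
    by (intro dim_kernel_dual subspace_kernel_dual bracket_functional e(4-6) subspace_UNIV)
  have "dim ?Y3 \<le> index"
  proof (rule x'(2))
    fix y assume y: "y \<in> ?Y3"
    show "bracket x y = 0 \<and> bracket x' y = 0"
      using y x x'(1) by (intro conjI e(10)) (simp_all add: stabilizer_left)
  qed
  then show False using 1 2 3 e(7,8) by linarith
qed

lemma extremal_sum_dim:
  assumes ext: "extremal_triple a b c"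
  shows "dim center + 4 \<le> dim {u + v |u v. u \<in> stabilizer a \<and> v \<in> stabilizer b}"
proof -
  note e = extremal_tripleD[OF ext]
  have "dim (stabilizer a \<inter> stabilizer b) \<le> dim center"
    using extremal_Int[OF ext] by (intro dim_subset) blast
  then show ?thesis
    using dim_sums_Int[OF subspace_stabilizer[OF e(4)] subspace_stabilizer[OF e(5)]] e(1,2,8)
    unfolding regular_def by linarith
qed

text \<open>
  All three functionals vanish on \<open>[u, L(a) + L(b)]\<close>: for \<open>c\<close> this uses that \<open>u + v\<close> lies in its
  stabilizer and that \<open>v\<close> commutes with \<open>L(b)\<close>. So \<open>u\<close> commutes with the \<open>(z + 4)\<close>-dimensional space
  \<open>L(a) + L(b)\<close>, and a single further condition makes the partner of \<open>u\<close> commute as well.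
\<close>

lemma extremal_sum_Int:
  assumes ext: "extremal_triple a b c"
    and uv: "u \<in> stabilizer a" "v \<in> stabilizer b" "u + v \<in> stabilizer c"
  shows "u + v \<in> center"
proof (rule ccontr)
  assume nz: "u + v \<notin> center"
  note e = extremal_tripleD[OF ext]
  have uz: "u \<notin> center"
  proof
    assume u: "u \<in> center"
    then have "u \<in> stabilizer c" using center_subset_stabilizer[OF e(6)] by blast
    from subspace_diff[OF subspace_stabilizer[OF e(6)] uv(3) this]
    have "v \<in> stabilizer c" by simp
    then have "v \<in> center" using extremal_Int[OF extremal_triple_rotate[OF ext] uv(2)] by blast
    then show False using subspace_add[OF subspace_center u] nz by blast
  qed
  obtain u' where u': "u' \<in> stabilizer a"
    "\<And>Y. (\<And>y. y \<in> Y \<Longrightarrow> bracket u y = 0 \<and> bracket u' y = 0) \<Longrightarrow> dim Y \<le> index"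
    using extremal_partner[OF ext uv(1) uz] by blast
  let ?S = "{u + v |u v. u \<in> stabilizer a \<and> v \<in> stabilizer b}"
  let ?Y = "{y \<in> ?S. c (bracket u' y) = 0}"
  have "subspace ?S" by (intro subspace_sums subspace_stabilizer e(4-6))
  then have "dim ?S \<le> dim ?Y + 1" by (intro dim_kernel_dual bracket_functional e(4-6))
  moreover have "dim ?Y \<le> index"
  proof (rule u'(2))
    fix y assume y: "y \<in> ?Y"
    then obtain p q where pq: "y = p + q" "p \<in> stabilizer a" "q \<in> stabilizer b" by blast
    have b: "b (bracket w y) = 0" if "w \<in> stabilizer a" for w
      by (simp add: pq(1) bracket_linear stabilizer_abelian[OF e(1) that pq(2)]
          stabilizer_right[OF e(5) pq(3)])
    have "c (bracket (u + v) q) = 0" using uv(3) by (rule stabilizer_left)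
    then have "c (bracket u y) = 0"
      using stabilizer_abelian[OF e(1) uv(1) pq(2)] stabilizer_abelian[OF e(2) uv(2) pq(3)]
      by (simp add: pq(1) bracket_linear)
    then have "bracket u y = 0" using uv(1) b by (intro e(10)) (simp_all add: stabilizer_left)
    moreover have "bracket u' y = 0"
      using u'(1) b y by (intro e(10)) (simp_all add: stabilizer_left)
    ultimately show "bracket u y = 0 \<and> bracket u' y = 0" by blast
  qed
  ultimately show False using extremal_sum_dim[OF ext] e(8) by linarith
qed

lemma extremal_decomposition:
  assumes ext: "extremal_triple a b c"
  obtains u v w where "u \<in> stabilizer a" "v \<in> stabilizer b" "w \<in> stabilizer c" "y = u + v + w"
proof -
  note e = extremal_tripleD[OF ext]
  let ?S = "{u + v |u v. u \<in> stabilizer a \<and> v \<in> stabilizer b}"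
  let ?T = "{s + w |s w. s \<in> ?S \<and> w \<in> stabilizer c}"
  have S: "subspace ?S" by (intro subspace_sums subspace_stabilizer e(4-6))
  have "?S \<inter> stabilizer c \<subseteq> center" using extremal_sum_Int[OF ext] by blast
  then have "dim (?S \<inter> stabilizer c) \<le> dim center" by (rule dim_subset)
  then have dT: "dim ?T \<ge> dim (UNIV :: 'l set)"
    using dim_sums_Int[OF S subspace_stabilizer[OF e(6)]] extremal_sum_dim[OF ext] e(3,7,8)
    unfolding regular_def by linarith
  have T: "subspace ?T" by (intro subspace_sums S subspace_stabilizer e(4-6))
  have "y \<in> ?T" unfolding subspace_dim_equal[OF T subspace_UNIV subset_UNIV dT] by (rule UNIV_I)
  then obtain t w u v where "y = t + w" "t = u + v" "u \<in> stabilizer a" "v \<in> stabilizer b"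
    "w \<in> stabilizer c"
    by (elim CollectE exE conjE) blast
  then show thesis using that[of u v w] by simp
qed

text \<open>
  If the third component of an element of the stabilizer of \<open>a + b + c\<close> is central, nothing remains
  to balance \<open>c([p, _])\<close> on \<open>L(b)\<close>; on \<open>L(a)\<close> and \<open>L(c)\<close> it vanishes anyway. So \<open>p\<close> lies in
  \<open>L(a) \<inter> L(c)\<close>.
\<close>

lemma extremal_component:
  assumes ext: "extremal_triple a b c"
    and pqr: "p \<in> stabilizer a" "q \<in> stabilizer b" "r \<in> center"
    and sum: "\<And>y. a (bracket (p + q + r) y) + b (bracket (p + q + r) y) + c (bracket (p + q + r) y) = 0"
  shows "p \<in> center"
proof -
  note e = extremal_tripleD[OF ext]
  have "c (bracket p y) = 0" for y
  proof -
    obtain u v w where y: "u \<in> stabilizer a" "v \<in> stabilizer b" "w \<in> stabilizer c" "y = u + v + w"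
      using extremal_decomposition[OF ext] .
    have "c (bracket p v) = 0"
      using sum[of v]
      by (simp add: bracket_linear functional_linear e(4-6) stabilizer_left[OF pqr(1)]
          stabilizer_right[OF e(5) y(2)] stabilizer_abelian[OF e(2) pqr(2) y(2)]
          center_bracket(1)[OF pqr(3)])
    then show ?thesis
      by (simp add: y(4) bracket_linear functional_linear e(4-6)
          stabilizer_abelian[OF e(1) pqr(1) y(1)] stabilizer_right[OF e(6) y(3)])
  qed
  then have "p \<in> stabilizer c" by (simp add: stabilizer_def)
  then show ?thesis
    using extremal_Int[OF extremal_triple_rotate[OF extremal_triple_swap[OF ext]] pqr(1)] by blast
qed

text \<open>
  Used contrapositively: a noncentral element of the stabilizer of \<open>a + b + c\<close> has only noncentral
  components, and these are then independent modulo the center.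
\<close>

lemma extremal_components:
  assumes ext: "extremal_triple a b c"
    and pqr: "p \<in> stabilizer a" "q \<in> stabilizer b" "r \<in> center"
    and sum: "\<And>y. a (bracket (p + q + r) y) + b (bracket (p + q + r) y) + c (bracket (p + q + r) y) = 0"
  shows "p + q + r \<in> center"
proof -
  have "p \<in> center" by (rule extremal_component[OF ext pqr sum])
  moreover have "q \<in> center"
    using sum by (intro extremal_component[OF extremal_triple_swap[OF ext] pqr(2,1,3)])
      (simp add: add_ac)
  ultimately show ?thesis using pqr(3) by (intro subspace_add subspace_center)
qed

lemma quadratic_root:
  fixes \<alpha> \<beta> \<gamma> :: 'k
  assumes "\<alpha> \<noteq> 0"
  obtains s where "\<gamma> + \<beta> * s + \<alpha> * s\<^sup>2 = 0"
proof -
  let ?f = "\<lambda>n. if n = 0 then \<gamma> else if n = 1 then \<beta> else (\<alpha> :: 'k)"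
  obtain s where "(\<Sum>k\<le>2. ?f k * s ^ k) = 0"
    using alg_closed[of 2 ?f] assms by auto
  then show thesis using that by (simp add: numeral_2_eq_2)
qed

text \<open>
  The quadratic form is \<open>c([p, q])\<close>, evaluated along the line \<open>x + s x'\<close> in the stabilizer of
  \<open>a + b + c\<close>; at a zero the three components commute.
\<close>

lemma no_extremal_triple: "\<not> extremal_triple a b c"
proof
  assume ext: "extremal_triple a b c"
  note e = extremal_tripleD[OF ext]
  \<comment> \<open>\<open>index_le\<close> makes the stabilizer of \<open>a + b + c\<close> at least two-dimensional modulo the center\<close>
  define \<zeta> where "\<zeta> x = a x + b x + c x" for x
  have \<zeta>: "\<zeta> \<in> dual_space"
    by (rule dual_spaceI) (simp_all add: \<zeta>_def functional_linear e(4-6) algebra_simps)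
  have R: "subspace (stabilizer \<zeta>)" by (rule subspace_stabilizer[OF \<zeta>])
  have dR: "dim center + 2 \<le> dim (stabilizer \<zeta>)" using index_le[OF \<zeta>] e(8) by simp
  have spc: "span center = center" using subspace_center by (simp only: span_eq_iff)
  have "\<not> stabilizer \<zeta> \<subseteq> center" using dR dim_subset[of "stabilizer \<zeta>" center] by auto
  then obtain x' where x': "x' \<in> stabilizer \<zeta>" "x' \<notin> center" by blast
  have "\<not> stabilizer \<zeta> \<subseteq> span (insert x' center)"
  proof
    assume "stabilizer \<zeta> \<subseteq> span (insert x' center)"
    from dim_mono[OF this] show False using dR x'(2) by (simp add: dim_insert spc)
  qed
  then obtain x where x: "x \<in> stabilizer \<zeta>" "x \<notin> span (insert x' center)" by blast
  obtain p q r where pqr: "p \<in> stabilizer a" "q \<in> stabilizer b" "r \<in> stabilizer c" "x = p + q + r"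
    using extremal_decomposition[OF ext] .
  obtain p' q' r' where pqr': "p' \<in> stabilizer a" "q' \<in> stabilizer b" "r' \<in> stabilizer c"
    "x' = p' + q' + r'"
    using extremal_decomposition[OF ext] .
  \<comment> \<open>if the leading coefficient of the quadratic polynomial vanishes, \<open>x'\<close> itself is a zero of the form\<close>
  have "\<exists>P Q R. P \<in> stabilizer a \<and> Q \<in> stabilizer b \<and> R \<in> stabilizer c
    \<and> P + Q + R \<in> stabilizer \<zeta> \<and> P + Q + R \<notin> center \<and> c (bracket P Q) = 0"
  proof (cases "c (bracket p' q') = 0")
    case True
    then show ?thesis using pqr' x' by blast
  next
    case False
    obtain s where s: "c (bracket p q) + (c (bracket p' q) + c (bracket p q')) * s
        + c (bracket p' q') * s\<^sup>2 = 0"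
      using quadratic_root[OF False] .
    let ?P = "p + scale s p'" and ?Q = "q + scale s q'" and ?R = "r + scale s r'"
    have X: "?P + ?Q + ?R = x + scale s x'" by (simp add: pqr(4) pqr'(4) algebra_simps)
    have "?P \<in> stabilizer a" "?Q \<in> stabilizer b" "?R \<in> stabilizer c"
      using pqr pqr' by (auto intro!: subspace_add subspace_scale subspace_stabilizer e(4-6))
    moreover have "?P + ?Q + ?R \<in> stabilizer \<zeta>"
      unfolding X using x x' R by (intro subspace_add subspace_scale)
    moreover have "?P + ?Q + ?R \<notin> center"
    proof
      assume "?P + ?Q + ?R \<in> center"
      then have "x - scale (- s) x' \<in> span center" unfolding X spc by simp
      then have "x \<in> span (insert x' center)" by (intro iffD2[OF span_breakdown_eq] exI)
      then show False using x(2) by blast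
    qed
    moreover have "c (bracket ?P ?Q) = 0"
      using s by (simp add: bracket_linear functional_linear e(4-6) algebra_simps power2_eq_square)
    ultimately show ?thesis by blast
  qed
  then obtain P Q R where P: "P \<in> stabilizer a" and Q: "Q \<in> stabilizer b" and R: "R \<in> stabilizer c"
    and X: "P + Q + R \<in> stabilizer \<zeta>" "P + Q + R \<notin> center" and PQ: "c (bracket P Q) = 0"
    by blast
  have sum: "a (bracket (P + Q + R) y) + b (bracket (P + Q + R) y) + c (bracket (P + Q + R) y) = 0" for y
    using stabilizer_left[OF X(1)] by (simp add: \<zeta>_def)
  have QP: "c (bracket Q P) = 0" using PQ bracket_anti[of Q P] by (simp add: functional_linear e(4-6))
  note left = stabilizer_left[OF P] stabilizer_left[OF Q] stabilizer_left[OF R]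
  note right = stabilizer_right[OF e(4) P] stabilizer_right[OF e(5) Q] stabilizer_right[OF e(6) R]
  \<comment> \<open>evaluating \<open>a + b + c\<close> at \<open>[P + Q + R, Q]\<close> leaves two terms, one of which is zero\<close>
  have aRQ: "a (bracket R Q) = 0"
    using sum[of Q] PQ by (simp add: bracket_linear functional_linear e(4-6) left right alternating)
  have bRP: "b (bracket R P) = 0"
    using sum[of P] QP by (simp add: bracket_linear functional_linear e(4-6) left right alternating)
  have br: "bracket P Q = 0" "bracket R Q = 0" "bracket R P = 0"
    using PQ aRQ bRP by (auto intro!: e(10) simp: left right)
  have br': "bracket Q P = 0" "bracket Q R = 0" "bracket P R = 0"
    using br bracket_anti[of P Q] bracket_anti[of R Q] bracket_anti[of R P] by simp_all
  have Rz: "R \<notin> center" using extremal_components[OF ext P Q _ sum] X(2) by blast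
  have Pz: "P \<notin> center"
  proof
    assume "P \<in> center"
    then have "Q + R + P \<in> center"
      by (rule extremal_components[OF extremal_triple_rotate[OF ext] Q R])
        (use sum in \<open>simp add: add_ac\<close>)
    then show False using X(2) by (simp add: add_ac)
  qed
  have Qz: "Q \<notin> center"
  proof
    assume "Q \<in> center"
    then have "R + P + Q \<in> center"
      by (rule extremal_components[OF extremal_triple_rotate[OF extremal_triple_rotate[OF ext]] R P])
        (use sum in \<open>simp add: add_ac\<close>)
    then show False using X(2) by (simp add: add_ac)
  qed
  have Ra: "subspace (stabilizer a)" and Rb: "subspace (stabilizer b)"
    by (simp_all add: subspace_stabilizer e(4-6))
  have Q1: "Q \<notin> span (insert P center)"
  proof
    assume "Q \<in> span (insert P center)"
    moreover have "span (insert P center) \<subseteq> stabilizer a"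
      using P center_subset_stabilizer[OF e(4)] Ra by (intro span_minimal) auto
    ultimately show False using extremal_Int[OF ext _ Q] Qz by blast
  qed
  have R1: "R \<notin> span (insert Q (insert P center))"
  proof
    assume R': "R \<in> span (insert Q (insert P center))"
    let ?S = "{u + v |u v. u \<in> stabilizer a \<and> v \<in> stabilizer b}"
    have "subspace ?S" by (intro subspace_sums subspace_stabilizer e(4-6))
    moreover have "u \<in> ?S" if "u \<in> stabilizer a" for u
      using sum_mem[OF that subspace_0[OF Rb]] by simp
    moreover have "v \<in> ?S" if "v \<in> stabilizer b" for v
      using sum_mem[OF subspace_0[OF Ra] that] by simp
    ultimately have "span (insert Q (insert P center)) \<subseteq> ?S"
      using P Q center_subset_stabilizer[OF e(4)] by (intro span_minimal) auto
    then have "R \<in> ?S" using R' by blast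
    then obtain u v where "R = u + v" "u \<in> stabilizer a" "v \<in> stabilizer b" by blast
    then show False using extremal_sum_Int[OF ext] R Rz by blast
  qed
  have "dim (span (insert R (insert Q (insert P center)))) = dim center + 3"
    using Pz Q1 R1 by (simp add: dim_insert spc)
  moreover have "abelian_subalgebra (span (insert R (insert Q (insert P center))))"
    by (rule abelian_span) (auto simp: br br' alternating center_bracket)
  ultimately show False using e(8,9) by fastforce
qed

lemma alpha_exceptional:
  assumes "dim (UNIV :: 'l set) = dim center + 6" "index = dim center + 2" "dim derived_algebra \<le> 3"
  shows "index + 1 \<le> alpha"
proof (rule ccontr)
  assume "\<not> index + 1 \<le> alpha"
  then have max: "dim A \<le> index" if "abelian_subalgebra A" for A
    using dim_le_alpha[OF that] by linarith
  obtain a where a: "regular a" using regular_exists by blast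
  have less: "index < dim (UNIV :: 'l set)" using assms(1,2) by linarith
  obtain b c where "regular b" "regular c"
    "\<And>u. u \<in> derived_algebra \<Longrightarrow> a u = 0 \<Longrightarrow> b u = 0 \<Longrightarrow> c u = 0 \<Longrightarrow> u = 0"
    using regular_separating_triple[OF a less assms(3)] by blast
  then have "extremal_triple a b c"
    unfolding extremal_triple_def using a assms(1,2) max by blast
  then show False using no_extremal_triple by blast
qed

section \<open>Bounds in small dimension\<close>

text \<open>
  Brackets with elements of \<open>L(a)\<close> stay in the kernel of \<open>a\<close> on the derived algebra. Hence the
  centralizer of \<open>L(a)\<close>, which is generated by \<open>index - dim center\<close> elements modulo the center, is
  larger than \<open>L(a)\<close>.
\<close>

lemma alpha_extend_stabilizer:
  assumes "(index - dim center) * (dim derived_algebra - 1) + index < dim (UNIV :: 'l set)"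
  shows "index + 1 \<le> alpha"
proof -
  obtain a where a: "regular a" using regular_exists by blast
  have d: "a \<in> dual_space" using a by (rule regular_dual)
  have Ra: "subspace (stabilizer a)" by (rule subspace_stabilizer[OF d])
  have dimRa: "dim (stabilizer a) = index" using a by (simp add: regular_def)
  obtain S where S: "finite S" "S \<subseteq> stabilizer a" "stabilizer a = span (center \<union> S)"
    "card S + dim center = dim (stabilizer a)"
    using span_center_decomposition[OF Ra center_subset_stabilizer[OF d]] .
  let ?D = "{u \<in> derived_algebra. a u = 0}"
  have "bracket x y \<in> ?D" if "x \<in> S" for x y
    using that S(2) bracket_derived stabilizer_left[of x a y] by blast
  then have "dim (UNIV :: 'l set) \<le> dim {y. \<forall>x\<in>S. bracket x y = 0} + card S * dim ?D"
    by (rule dim_centralizer[OF S(1)])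
  moreover have "dim ?D \<le> dim derived_algebra - 1"
    using derived_kernel_less[OF a] assms by linarith
  then have "card S * dim ?D \<le> card S * (dim derived_algebra - 1)" by (rule mult_le_mono2)
  moreover have cS: "card S = index - dim center" using S(4) dimRa by linarith
  ultimately have lt: "index < dim {y. \<forall>x\<in>S. bracket x y = 0}"
    using assms unfolding cS by linarith
  have eqC: "{y. \<forall>x\<in>stabilizer a. bracket x y = 0} = {y. \<forall>x\<in>S. bracket x y = 0}"
    by (simp only: S(3) centralizer_span_center)
  from lt have less: "dim (stabilizer a) < dim {y. \<forall>x\<in>stabilizer a. bracket x y = 0}"
    unfolding dimRa eqC .
  have "abelian_subalgebra (stabilizer a)"
    using stabilizer_abelian[OF a] Ra by (intro abelian_subspace)
  from abelian_extend[OF this less] obtain y where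
    "abelian_subalgebra (span (insert y (stabilizer a)))"
    "dim (span (insert y (stabilizer a))) = dim (stabilizer a) + 1" by blast
  then show ?thesis using dim_le_alpha dimRa by fastforce
qed

lemma alpha_greedy:
  assumes "\<And>j. j < k \<Longrightarrow> dim center + j + j * dim derived_algebra < dim (UNIV :: 'l set)"
  shows "dim center + k \<le> alpha"
  using greedy_abelian[OF assms] dim_le_alpha by metis

lemma dim_plus_index_le:
  assumes metab: "metabelian" and d2: "2 \<le> dim derived_algebra" and n9: "dim (UNIV :: 'l set) \<le> 9"
  shows "dim (UNIV :: 'l set) + index \<le> 2 * alpha + 2"
proof -
  obtain n z i d where defs: "dim (UNIV :: 'l set) = n" "dim center = z" "index = i"
    "dim derived_algebra = d" by blast
  obtain a where a: "regular a" using regular_exists by blast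
  have "z \<le> i"
    using dim_subset[OF center_subset_stabilizer[OF regular_dual[OF a]]] a
    unfolding regular_def defs by simp
  moreover have "d \<le> z"
    using dim_subset metab unfolding metabelian_def defs(2,4)[symmetric] by blast
  moreover have "i \<le> n"
    using dim_subset[OF subset_UNIV, of "stabilizer a"] a unfolding regular_def defs by simp
  moreover have "even (n + i)" using even_dim_plus_index unfolding defs .
  moreover have "i \<le> alpha" using index_le_alpha unfolding defs .
  ultimately have b: "z \<le> i" "d \<le> z" "i \<le> n" "even (n + i)" "i \<le> alpha" "2 \<le> d" "n \<le> 9"
    using d2 n9 unfolding defs by blast+
  \<comment> \<open>\<open>n \<le> 9\<close> and \<open>2 \<le> d \<le> z \<le> i\<close>\<close>
  then have "n \<le> i + 7" by linarith
  then have "n \<le> i + 2 \<or> n = i + 4 \<or> n = i + 6" using b(4) by presburger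
  then consider "n \<le> i + 2" | "n = i + 4" | "n = i + 6" by blast
  then have "n + i \<le> 2 * alpha + 2"
  proof cases
    case 1
    then show ?thesis using b by linarith
  next
    case 2
    have "i + 1 \<le> alpha"
    proof (cases "(i - z) * (d - 1) < 4")
      case True
      then show ?thesis using alpha_extend_stabilizer 2 unfolding defs by simp
    next
      case False
      \<comment> \<open>here \<open>i - z \<le> 5 - d\<close>, and \<open>(5 - d) (d - 1)\<close> reaches \<open>4\<close> only for \<open>d = 3\<close>\<close>
      have "d = 2 \<or> d = 3 \<or> d = 4 \<or> d = 5" using b 2 by linarith
      then have "d = 3 \<and> i = z + 2" using False b 2 by auto
      then show ?thesis using alpha_exceptional 2 unfolding defs by simp
    qed
    then show ?thesis using 2 by linarith
  next
    case 3
    \<comment> \<open>as \<open>z \<ge> 2\<close> and \<open>n \<le> 9\<close>, the quotient \<open>L / Z\<close> has dimension \<open>6\<close> or \<open>7\<close>\<close>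
    have "i = z \<or> i = z + 1" using b 3 by linarith
    then have "z + (i + 2 - z) \<le> alpha"
    proof
      assume i: "i = z"
      have "z + j + j * d < n" if "j < 2" for j
      proof -
        have "d \<le> 3" "j = 0 \<or> j = 1" using b i 3 that by linarith+
        then show ?thesis using i 3 by auto
      qed
      then have "z + 2 \<le> alpha" using alpha_greedy[of 2] unfolding defs by blast
      then show ?thesis using i by simp
    next
      assume i: "i = z + 1"
      have "z + j + j * d < n" if "j < 3" for j
      proof -
        have "d = 2" "j = 0 \<or> j = 1 \<or> j = 2" using b i 3 that by linarith+
        then show ?thesis using i 3 by auto
      qed
      then have "z + 3 \<le> alpha" using alpha_greedy[of 3] unfolding defs by blast
      then show ?thesis using i by simp
    qed
    then show ?thesis using 3 b by linarith
  qed
  then show ?thesis unfolding defs .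
qed

end

section \<open>Rentschler's property\<close>

theorem theorem7p4:
  fixes scale :: "'k::{alg_closed_field, field_char_0} \<Rightarrow> 'l::ab_group_add \<Rightarrow> 'l"
    and bracket :: "'l \<Rightarrow> 'l \<Rightarrow> 'l"
    and n :: nat
  assumes "fin_dim_lie_algebra scale bracket"
    and "vector_space.dim scale (UNIV :: 'l set) = n"
    and "lie_algebra.metabelian scale bracket"
    and "vector_space.dim scale (lie_algebra.derived_algebra scale bracket) \<ge> 2"
    and "n \<le> 9"
  shows "lie_algebra.rentschler_property scale bracket"
proof -
  interpret fin_dim_lie_algebra scale bracket by fact
  obtain F where F: "finite F" "span F = UNIV" using finite_dimensional by (elim exE conjE)
  obtain B where B: "independent B" "UNIV \<subseteq> span B"
    using basis_exists[of UNIV] .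
  have "finite B" using independent_span_bound[OF F(1) B(1)] F(2) by simp
  then interpret lie_algebra_with_basis scale bracket B
    using B by unfold_locales auto
  have "dim (UNIV :: 'l set) \<le> 9" using assms(2,5) by (simp only:)
  from dim_plus_index_le[OF assms(3,4) this]
  have "(of_nat (dim (UNIV :: 'l set) + index) :: rat) \<le> of_nat (2 * alpha + 2)"
    by (simp only: of_nat_le_iff)
  then have "(of_nat (dim (UNIV :: 'l set)) + of_nat index :: rat) \<le> 2 * of_nat alpha + 2"
    by (simp only: of_nat_add of_nat_mult of_nat_numeral)
  moreover have "(x + y) / 2 - 1 \<le> a" if "x + y \<le> 2 * a + 2" for x y a :: rat
    using that by (simp add: field_simps)
  ultimately show ?thesis
    unfolding rentschler_property_def magic_number_def by blast
qed

end
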